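(* Let $\tau_1$ and $\tau_2$ be monomial orders on $S=K[x_1,\dots,x_n]$ (in the sense of the context). Then $gin_{\tau_1}(I)=gin_{\tau_2}(I)$ for all ideals $I\subset S$ if and only if $\tau_1=\tau_2$.
   Context: $K$ is an algebraically closed field of characteristic $0$ and $S=K[x_1,\dots,x_n]$ is the standard graded polynomial ring; $S_1$ is its space of linear forms. A monomial order $\tau$ means a total order $>_\tau$ on the monomials of $S$ with $x_1>_\tau x_2>_\tau\dots>_\tau x_n$ that is graded ($\deg f>\deg g$ implies $f>_\tau g$ for monomials $f,g$) and multiplicative ($f>_\tau g$ implies $fh>_\tau gh$ for monomials $f,g,h$). For a nonzero $f\in S$, $in_\tau(f)$ is its $\tau$-largest monomial, and for an ideal $I$, $in_\tau(I)$ is the monomial ideal generated by all $in_\tau(f)$, $0\neq f\in I$. A matrix $g\in GL(S_1)$ acts on $S$ by the induced linear change of coordinates. By a theorem of Galligo, for a given ideal $I$ and monomial order $\tau$ there is a nonempty Zariski open subset $U\subset GL(S_1)$ such that $in_\tau(g(I))$ is the same ideal for all $g\in U$; this ideal is the generic initial ideal, denoted $gin_\tau(I)$. *)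

theory Defs
  imports "HOL-Analysis.Determinants" "HOL-Library.Poly_Mapping"
    "HOL-Computational_Algebra.Polynomial"
begin

text \<open>
  The variables are indexed by a finite linearly ordered type \<open>'n\<close>, whose elements in increasing
  order play the role of \<open>1, \<dots>, n\<close>. A monomial is given by its exponent vector, so the product of
  monomials is addition of exponent vectors.
\<close>

type_synonym 'n mono = "'n \<Rightarrow>\<^sub>0 nat"
type_synonym ('n, 'k) mpoly = "'n mono \<Rightarrow>\<^sub>0 'k"

definition Const :: "'k::zero \<Rightarrow> ('n, 'k) mpoly" where
  "Const c = Poly_Mapping.single 0 c"

definition Var :: "'n \<Rightarrow> ('n, 'k::zero_neq_one) mpoly" where
  "Var i = Poly_Mapping.single (Poly_Mapping.single i 1) 1"

definition mono_deg :: "'n mono \<Rightarrow> nat" where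
  "mono_deg m = (\<Sum>i\<in>Poly_Mapping.keys m. Poly_Mapping.lookup m i)"

text \<open>
  The image of \<open>p\<close> under the ring homomorphism that acts on the coefficients by \<open>c\<close> and sends the
  variable with index \<open>i\<close> to \<open>a i\<close>. Evaluation at a point is \<open>subst_hom id a\<close>; with \<open>c = Const\<close> it
  is substitution of polynomials for the variables.
\<close>

definition subst_hom :: "('k::zero \<Rightarrow> 'r::comm_semiring_1) \<Rightarrow> ('i \<Rightarrow> 'r) \<Rightarrow> ('i, 'k) mpoly \<Rightarrow> 'r" where
  "subst_hom c a p =
     (\<Sum>m\<in>Poly_Mapping.keys p. c (Poly_Mapping.lookup p m) *
        (\<Prod>i\<in>Poly_Mapping.keys m. a i ^ Poly_Mapping.lookup m i))"

text \<open>Ideals are the submodules of the ring as a module over itself.\<close>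

lemma module_times: "module ((*) :: 'r::comm_ring_1 \<Rightarrow> 'r \<Rightarrow> 'r)"
  by standard (simp_all add: algebra_simps)

definition is_ideal :: "'r::comm_ring_1 set \<Rightarrow> bool" where
  "is_ideal I \<longleftrightarrow> module.subspace (*) I"

definition ideal_gen :: "'r::comm_ring_1 set \<Rightarrow> 'r set" where
  "ideal_gen B = module.span (*) B"

text \<open>A monomial order is given by its strict relation: \<open>\<tau> u v\<close> reads \<open>u >\<^sub>\<tau> v\<close>.\<close>

definition monomial_order :: "('n::{finite, linorder} mono \<Rightarrow> 'n mono \<Rightarrow> bool) \<Rightarrow> bool" where
  "monomial_order \<tau> \<longleftrightarrow>
     irreflp \<tau> \<and> transp \<tau> \<and> totalp \<tau> \<and>
     (\<forall>i j. i < j \<longrightarrow> \<tau> (Poly_Mapping.single i 1) (Poly_Mapping.single j 1)) \<and>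
     (\<forall>u v. mono_deg u > mono_deg v \<longrightarrow> \<tau> u v) \<and>
     (\<forall>u v w. \<tau> u v \<longrightarrow> \<tau> (u + w) (v + w))"

text \<open>Only meaningful for nonzero \<open>f\<close>.\<close>

definition lead_mono :: "('n mono \<Rightarrow> 'n mono \<Rightarrow> bool) \<Rightarrow> ('n, 'k::zero) mpoly \<Rightarrow> 'n mono" where
  "lead_mono \<tau> f = (THE m. m \<in> Poly_Mapping.keys f \<and> (\<forall>u\<in>Poly_Mapping.keys f. u \<noteq> m \<longrightarrow> \<tau> m u))"

definition initial_ideal ::
  "('n mono \<Rightarrow> 'n mono \<Rightarrow> bool) \<Rightarrow> ('n, 'k::comm_ring_1) mpoly set \<Rightarrow> ('n, 'k) mpoly set" where
  "initial_ideal \<tau> I = ideal_gen {Poly_Mapping.single (lead_mono \<tau> f) 1 | f. f \<in> I \<and> f \<noteq> 0}"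

text \<open>
  The matrix \<open>g\<close> acts on linear forms by sending the variable with index \<open>j\<close> to the linear form
  given by the \<open>j\<close>-th column of \<open>g\<close>.
\<close>

definition lin_change :: "'k::comm_ring_1^'n^'n \<Rightarrow> ('n, 'k) mpoly \<Rightarrow> ('n, 'k) mpoly" where
  "lin_change g f = subst_hom Const (\<lambda>j. \<Sum>i\<in>UNIV. Const (g $ i $ j) * Var i) f"

text \<open>
  The Zariski topology on the general linear group is the subspace topology from the affine space of
  all matrices: its open sets are the loci where some member of a set of polynomials in the matrix
  entries does not vanish.
\<close>

definition zariski_open_GL :: "('k::comm_ring_1^'n^'n) set \<Rightarrow> bool" where
  "zariski_open_GL U \<longleftrightarrow>
     (\<exists>P :: ('n \<times> 'n, 'k) mpoly set.
        U = {g. invertible g \<and> (\<exists>p\<in>P. subst_hom id (\<lambda>(i, j). g $ i $ j) p \<noteq> 0)})"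

text \<open>
  Galligo's theorem provides the ideal described here; it is unique because any two nonempty Zariski
  open subsets of the general linear group over an infinite field intersect.
\<close>

definition gin ::
  "('n::finite mono \<Rightarrow> 'n mono \<Rightarrow> bool) \<Rightarrow> ('n, 'k::comm_ring_1) mpoly set \<Rightarrow> ('n, 'k) mpoly set" where
  "gin \<tau> I = (THE J. \<exists>U :: ('k^'n^'n) set. zariski_open_GL U \<and> U \<noteq> {} \<and>
     (\<forall>g\<in>U. initial_ideal \<tau> (lin_change g ` I) = J))"

end

theory Submission
  imports "Jordan_Normal_Form.Determinant" Defs
begin

text \<open>
  Only the direction from equal generic initial ideals to equal orders has content. If two monomial
  orders differ, they differ on two monomials of the same degree \<open>d\<close>, because both are graded. Hence
  there is a set \<open>A\<close> of monomials of degree \<open>d\<close> that is an initial segment (the largest elements)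
  for both orders, while the largest remaining monomial of degree \<open>d\<close> is \<open>u\<close> for the first order and
  \<open>v \<noteq> u\<close> for the second (\<open>monomial_orders_separation\<close>).

  The two orders are told apart by the ideal \<open>I = span (A \<union> {u + v}) + \<mm>\<^sup>d\<^sup>+\<^sup>1\<close>, where \<open>\<mm>\<close> is the ideal
  generated by the variables. Galligo's theorem can be made explicit for an ideal of the shape
  \<open>V + \<mm>\<^sup>d\<^sup>+\<^sup>1\<close> with \<open>V\<close> of dimension \<open>r\<close> in degree \<open>d\<close>: a coordinate change \<open>g\<close> maps it to
  \<open>g V + \<mm>\<^sup>d\<^sup>+\<^sup>1\<close>, and if the coefficients of a basis of \<open>g V\<close> at the \<open>r\<close> largest monomials of
  degree \<open>d\<close> form a nonsingular matrix, then Gaussian elimination shows that the initial ideal is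
  generated by these \<open>r\<close> monomials and all monomials of larger degree (\<open>lead_monos_forms_ideal\<close>). The
  determinant of this matrix is a polynomial in the entries of \<open>g\<close>
  (\<open>zariski_open_coeff_minor\<close>), so the condition is Zariski open, and the resulting ideal is the
  generic initial ideal as soon as the condition holds for one \<open>g\<close> (\<open>gin_forms_ideal\<close>). For the ideal
  \<open>I\<close> it holds at the identity, for both orders: the matrix at \<open>A \<union> {u}\<close> and the one at
  \<open>A \<union> {v}\<close> are identity matrices. So \<open>u\<close> lies in the first generic initial ideal but not in the
  second.

  That the generic initial ideal is well defined rests on the fact that two nonempty Zariski open
  sets of invertible matrices over an infinite field intersect (\<open>zariski_open_GL_inter\<close>); this is
  seen on the line through a point of each.
\<close>

(* With this notation for vector entries out of the way, the dollar sign denotes matrix entries. *)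
no_notation vec_index (infixl \<open>$\<close> 100)

section \<open>Substitution homomorphisms\<close>

lemma poly_mapping_eq_sum_single:
  "p = (\<Sum>m\<in>Poly_Mapping.keys p. Poly_Mapping.single m (Poly_Mapping.lookup p m))"
proof (rule poly_mapping_eqI)
  fix k
  show "Poly_Mapping.lookup p k = Poly_Mapping.lookup
      (\<Sum>m\<in>Poly_Mapping.keys p. Poly_Mapping.single m (Poly_Mapping.lookup p m)) k"
    by (cases "k \<in> Poly_Mapping.keys p")
      (auto simp: lookup_sum lookup_single when_def in_keys_iff sum.delta)
qed

definition monomial_value :: "('i \<Rightarrow> 'r::comm_semiring_1) \<Rightarrow> 'i mono \<Rightarrow> 'r" where
  "monomial_value a m = (\<Prod>i\<in>Poly_Mapping.keys m. a i ^ Poly_Mapping.lookup m i)"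

lemma monomial_value_superset:
  assumes "finite A" "Poly_Mapping.keys m \<subseteq> A"
  shows "monomial_value a m = (\<Prod>i\<in>A. a i ^ Poly_Mapping.lookup m i)"
  unfolding monomial_value_def
  by (rule prod.mono_neutral_left) (use assms in \<open>auto simp: in_keys_iff\<close>)

lemma monomial_value_add:
  "monomial_value a (m + l) = monomial_value a m * monomial_value a l"
proof -
  let ?A = "Poly_Mapping.keys m \<union> Poly_Mapping.keys l"
  have "Poly_Mapping.keys (m + l) \<subseteq> ?A" by (rule keys_add)
  then show ?thesis
    by (simp add: monomial_value_superset[of ?A] lookup_add power_add prod.distrib)
qed

lemma subst_hom_superset:
  assumes "finite A" "Poly_Mapping.keys p \<subseteq> A" "c 0 = 0"
  shows "subst_hom c a p = (\<Sum>m\<in>A. c (Poly_Mapping.lookup p m) * monomial_value a m)"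
  unfolding subst_hom_def monomial_value_def
  by (rule sum.mono_neutral_left) (use assms in \<open>auto simp: in_keys_iff\<close>)

lemma subst_hom_single:
  assumes "c 0 = 0"
  shows "subst_hom c a (Poly_Mapping.single m x) = c x * monomial_value a m"
  using assms by (simp add: subst_hom_superset[of "{m}"])

lemma (in comm_ring_hom) comm_ring_hom_subst_hom: "comm_ring_hom (subst_hom hom a)"
proof -
  let ?S = "subst_hom hom a"
  have add: "?S (p + q) = ?S p + ?S q" for p q
    using keys_add[of p q]
    by (simp add: subst_hom_superset[of "Poly_Mapping.keys p \<union> Poly_Mapping.keys q"]
        lookup_add hom_add distrib_right sum.distrib)
  have zero: "?S 0 = 0" by (simp add: subst_hom_def)
  have sum: "?S (sum f A) = (\<Sum>x\<in>A. ?S (f x))" for f :: "'c mono \<Rightarrow> ('c, 'a) mpoly" and A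
    by (induction A rule: infinite_finite_induct) (auto simp: add zero)
  have single: "?S (Poly_Mapping.single m x * Poly_Mapping.single l y)
      = ?S (Poly_Mapping.single m x) * ?S (Poly_Mapping.single l y)" for m l x y
    by (simp add: mult_single subst_hom_single monomial_value_add hom_mult ac_simps)
  have mult: "?S (p * q) = ?S p * ?S q" for p q
  proof -
    have "?S (p * q) = (\<Sum>m\<in>Poly_Mapping.keys p. \<Sum>l\<in>Poly_Mapping.keys q.
        ?S (Poly_Mapping.single m (Poly_Mapping.lookup p m)
          * Poly_Mapping.single l (Poly_Mapping.lookup q l)))"
      by (subst poly_mapping_eq_sum_single[of p], subst poly_mapping_eq_sum_single[of q])
        (simp only: sum_product sum)
    also have "\<dots> = ?S (\<Sum>m\<in>Poly_Mapping.keys p. Poly_Mapping.single m (Poly_Mapping.lookup p m))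
        * ?S (\<Sum>l\<in>Poly_Mapping.keys q. Poly_Mapping.single l (Poly_Mapping.lookup q l))"
      by (simp only: single sum sum_product)
    finally show ?thesis
      by (simp only: poly_mapping_eq_sum_single[symmetric])
  qed
  have one: "?S 1 = 1"
    using subst_hom_single[of hom a 0 1] by (simp add: monomial_value_def)
  show ?thesis
    by unfold_locales (use add mult one zero in auto)
qed

text \<open>
  The identities between substitutions below (composition of coordinate changes, evaluation of
  generic coordinate changes, restriction of polynomials to a line) are instances of this rule.
\<close>

lemma (in comm_ring_hom) hom_subst_hom:
  "hom (subst_hom c a p) = subst_hom (\<lambda>x. hom (c x)) (\<lambda>i. hom (a i)) p"
  by (simp add: subst_hom_def hom_sum hom_mult hom_prod hom_power)

lemma subst_hom_Const: "c 0 = 0 \<Longrightarrow> subst_hom c a (Const x) = c x"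
  by (simp add: Const_def subst_hom_single monomial_value_def)

lemma subst_hom_Var: "c 0 = 0 \<Longrightarrow> c 1 = 1 \<Longrightarrow> subst_hom c a (Var i) = a i"
  by (simp add: Var_def subst_hom_single monomial_value_def)

lemma comm_ring_hom_Const: "comm_ring_hom (Const :: 'k::comm_ring_1 \<Rightarrow> ('n, 'k) mpoly)"
  by unfold_locales (auto simp: Const_def single_add mult_single)

lemma lookup_Const_mult:
  fixes f :: "('n, 'k::comm_ring_1) mpoly"
  shows "Poly_Mapping.lookup (Const c * f) m = c * Poly_Mapping.lookup f m"
  by (cases "c = 0")
    (auto simp: Const_def mult_map_scale_conv_mult[symmetric] map.rep_eq when_def)

lemma Var_power:
  "(Var i :: ('n, 'k::comm_ring_1) mpoly) ^ k = Poly_Mapping.single (Poly_Mapping.single i k) 1"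
  by (induction k) (auto simp: Var_def mult_single single_add[symmetric])

lemma monomial_value_Var:
  "monomial_value (Var :: _ \<Rightarrow> ('n, 'k::comm_ring_1) mpoly) m = Poly_Mapping.single m 1"
proof -
  have "(\<Prod>i\<in>A. Var i ^ Poly_Mapping.lookup m i :: ('n, 'k) mpoly)
      = Poly_Mapping.single (\<Sum>i\<in>A. Poly_Mapping.single i (Poly_Mapping.lookup m i)) 1" for A
    by (induction A rule: infinite_finite_induct) (auto simp: Var_power mult_single)
  then show ?thesis
    unfolding monomial_value_def by (simp flip: poly_mapping_eq_sum_single)
qed

text \<open>
  Through this presentation as a substitution, a coefficientwise map given by a ring homomorphism is
  itself a ring homomorphism and can be pushed through further substitutions; it is applied to the
  evaluation of polynomials whose coefficients are polynomials.
\<close>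

lemma lookup_subst_hom_Const_Var:
  fixes p :: "('n, 'a::comm_ring_1) mpoly" and h :: "'a \<Rightarrow> 'k::comm_ring_1"
  assumes "h 0 = 0"
  shows "Poly_Mapping.lookup (subst_hom (\<lambda>c. Const (h c)) Var p) m = h (Poly_Mapping.lookup p m)"
proof -
  have "subst_hom (\<lambda>c. Const (h c)) Var p = (\<Sum>m\<in>Poly_Mapping.keys p.
      Poly_Mapping.single m (h (Poly_Mapping.lookup p m)) :: ('n, 'k) mpoly)"
    unfolding subst_hom_def monomial_value_def[symmetric]
    by (simp add: monomial_value_Var Const_def mult_single)
  then have "Poly_Mapping.lookup (subst_hom (\<lambda>c. Const (h c)) Var p) m
      = (\<Sum>l\<in>Poly_Mapping.keys p. if l = m then h (Poly_Mapping.lookup p l) else 0)"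
    by (simp add: lookup_sum lookup_single when_def)
  also have "\<dots> = h (Poly_Mapping.lookup p m)"
    using assms by (simp add: sum.delta in_keys_iff)
  finally show ?thesis .
qed

section \<open>Linear changes of coordinates\<close>

lemma comm_ring_hom_lin_change: "comm_ring_hom (lin_change g)"
  unfolding lin_change_def
  by (rule comm_ring_hom.comm_ring_hom_subst_hom[OF comm_ring_hom_Const])

lemma lin_change_Const: "lin_change g (Const c) = Const c"
  by (simp add: lin_change_def subst_hom_Const Const_def[of 0])

lemma lin_change_Var: "lin_change g (Var j) = (\<Sum>i\<in>UNIV. Const (g $ i $ j) * Var i)"
  by (simp add: lin_change_def subst_hom_Var Const_def[of 0] Const_def[of 1])

lemma lin_change_lin_change:
  fixes g h :: "'k::comm_ring_1^'n^'n"
  shows "lin_change g (lin_change h f) = lin_change (g ** h) f"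
proof -
  interpret L: comm_ring_hom "lin_change g" by (rule comm_ring_hom_lin_change)
  interpret C: comm_ring_hom "Const :: 'k \<Rightarrow> ('n, 'k) mpoly" by (rule comm_ring_hom_Const)
  have "(\<Sum>i\<in>UNIV. Const (h $ i $ j) * (\<Sum>k\<in>UNIV. Const (g $ k $ i) * Var k))
      = (\<Sum>k\<in>UNIV. Const ((g ** h) $ k $ j) * Var k :: ('n, 'k) mpoly)" for j
  proof -
    have "(\<Sum>i\<in>UNIV. Const (h $ i $ j) * (\<Sum>k\<in>UNIV. Const (g $ k $ i) * Var k))
      = (\<Sum>i\<in>UNIV. \<Sum>k\<in>UNIV. Const (g $ k $ i) * Const (h $ i $ j) * Var k :: ('n, 'k) mpoly)"
      by (simp add: sum_distrib_left ac_simps)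
    also have "\<dots> = (\<Sum>k\<in>UNIV. \<Sum>i\<in>UNIV. Const (g $ k $ i) * Const (h $ i $ j) * Var k)"
      by (rule sum.swap)
    finally show ?thesis
      by (simp add: matrix_matrix_mult_def C.hom_sum C.hom_mult sum_distrib_right)
  qed
  then show ?thesis
    unfolding lin_change_def[of h] lin_change_def[of "g ** h"]
    by (simp add: L.hom_subst_hom L.hom_sum L.hom_mult lin_change_Const lin_change_Var)
qed

lemma lin_change_mat_1: "lin_change (mat 1) f = (f :: ('n::finite, 'k::comm_ring_1) mpoly)"
proof -
  have "(\<Sum>i\<in>UNIV. Const ((mat 1 :: 'k^'n^'n) $ i $ j) * Var i) = (Var j :: ('n, 'k) mpoly)" for j
  proof -
    have "(\<Sum>i\<in>UNIV. Const ((mat 1 :: 'k^'n^'n) $ i $ j) * Var i)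
       = (\<Sum>i\<in>UNIV. if i = j then Var i else (0 :: ('n, 'k) mpoly))"
      by (rule sum.cong) (auto simp: Finite_Cartesian_Product.mat_def Const_def)
    then show ?thesis by simp
  qed
  moreover have "subst_hom Const Var f = f"
    by (rule poly_mapping_eqI) (use lookup_subst_hom_Const_Var[of "\<lambda>x. x" f] in simp)
  ultimately show ?thesis by (simp add: lin_change_def)
qed


section \<open>Powers of the irrelevant maximal ideal\<close>

text \<open>
  The \<open>d\<close>-th power of the ideal generated by the variables, described by the degrees of the
  monomials that occur.
\<close>

definition max_power :: "nat \<Rightarrow> ('n, 'k::zero) mpoly set" where
  "max_power d = {f. \<forall>m\<in>Poly_Mapping.keys f. d \<le> mono_deg m}"

lemma mono_deg_UNIV: "mono_deg m = (\<Sum>i\<in>UNIV. Poly_Mapping.lookup m i)"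
  for m :: "'n::finite mono"
  unfolding mono_deg_def by (rule sum.mono_neutral_left) (auto simp: in_keys_iff)

lemma mono_deg_add: "mono_deg (u + v) = mono_deg u + mono_deg v" for u v :: "'n::finite mono"
  by (simp add: mono_deg_UNIV lookup_add sum.distrib)

lemma mono_deg_single: "mono_deg (Poly_Mapping.single i k) = k"
  by (simp add: mono_deg_def)

lemma mono_deg_eq_0: "mono_deg m = 0 \<longleftrightarrow> m = 0" for m :: "'n::finite mono"
  by (simp add: mono_deg_UNIV poly_mapping_eq_iff fun_eq_iff)

lemma finite_mono_deg_eq: "finite {m :: 'n::finite mono. mono_deg m = d}"
proof (rule finite_imageD)
  have "Poly_Mapping.lookup m \<in> (UNIV \<rightarrow> {..d})" if "mono_deg m = d" for m :: "'n mono"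
  proof
    fix i
    show "Poly_Mapping.lookup m i \<in> {..d}"
      using member_le_sum[of i UNIV "Poly_Mapping.lookup m"] that by (simp add: mono_deg_UNIV)
  qed
  then have "Poly_Mapping.lookup ` {m :: 'n mono. mono_deg m = d} \<subseteq> (UNIV \<rightarrow> {..d})" by blast
  moreover have "finite ((UNIV :: 'n set) \<rightarrow> {..d})"
    using finite_PiE[of "UNIV :: 'n set" "\<lambda>_. {..d}"] by (simp add: PiE_UNIV_domain)
  ultimately show "finite (Poly_Mapping.lookup ` {m :: 'n mono. mono_deg m = d})"
    by (rule finite_subset)
  show "inj_on Poly_Mapping.lookup {m :: 'n mono. mono_deg m = d}"
    by (simp add: inj_on_def)
qed

lemma max_power_0 [simp]: "f \<in> max_power 0"
  by (simp add: max_power_def)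

lemma zero_in_max_power [simp]: "0 \<in> max_power d"
  by (simp add: max_power_def)

lemma max_power_antimono: "f \<in> max_power d \<Longrightarrow> e \<le> d \<Longrightarrow> f \<in> max_power e"
  by (auto simp: max_power_def intro: order_trans)

lemma add_in_max_power: "f \<in> max_power d \<Longrightarrow> g \<in> max_power d \<Longrightarrow> f + g \<in> max_power d"
  using keys_add[of f g] by (auto simp: max_power_def)

lemma sum_in_max_power: "(\<And>x. x \<in> A \<Longrightarrow> f x \<in> max_power d) \<Longrightarrow> sum f A \<in> max_power d"
  by (induction A rule: infinite_finite_induct) (auto intro: add_in_max_power)

lemma mult_in_max_power:
  fixes f g :: "('n::finite, 'k::comm_ring_1) mpoly"
  assumes "f \<in> max_power a" "g \<in> max_power b"
  shows "f * g \<in> max_power (a + b)"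
  unfolding max_power_def
proof (intro CollectI ballI)
  fix m assume "m \<in> Poly_Mapping.keys (f * g)"
  then obtain u v where "m = u + v" "u \<in> Poly_Mapping.keys f" "v \<in> Poly_Mapping.keys g"
    using keys_mult[of f g] by blast
  then show "a + b \<le> mono_deg m"
    using assms by (simp add: max_power_def mono_deg_add add_mono)
qed

lemma mult_left_in_max_power:
  fixes f g :: "('n::finite, 'k::comm_ring_1) mpoly"
  shows "g \<in> max_power b \<Longrightarrow> f * g \<in> max_power b"
  using mult_in_max_power[OF max_power_0, of g b f] by simp

lemma power_in_max_power:
  fixes f :: "('n::finite, 'k::comm_ring_1) mpoly"
  shows "f \<in> max_power 1 \<Longrightarrow> f ^ k \<in> max_power k"
proof (induction k)
  case (Suc k)
  from mult_in_max_power[OF Suc.prems Suc.IH[OF Suc.prems]] show ?case by simp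
qed simp

lemma prod_in_max_power:
  fixes f :: "'a \<Rightarrow> ('n::finite, 'k::comm_ring_1) mpoly"
  assumes "\<And>x. x \<in> A \<Longrightarrow> f x \<in> max_power (e x)"
  shows "prod f A \<in> max_power (sum e A)"
  using assms
proof (induction A rule: infinite_finite_induct)
  case (insert x A)
  then have "f x * prod f A \<in> max_power (e x + sum e A)"
    by (intro mult_in_max_power) simp_all
  with insert.hyps show ?case by simp
qed simp_all

lemma Var_in_max_power: "Var i \<in> (max_power 1 :: ('n, 'k::comm_ring_1) mpoly set)"
  by (simp add: max_power_def Var_def mono_deg_single)

lemma lin_change_in_max_power:
  fixes f :: "('n::finite, 'k::comm_ring_1) mpoly"
  assumes "f \<in> max_power d"
  shows "lin_change g f \<in> max_power d"
  unfolding lin_change_def subst_hom_def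
proof (intro sum_in_max_power mult_left_in_max_power)
  fix m assume "m \<in> Poly_Mapping.keys f"
  then have "d \<le> mono_deg m" using assms by (simp add: max_power_def)
  moreover have "(\<Sum>i\<in>UNIV. Const (g $ i $ j) * Var i) \<in> (max_power 1 :: ('n, 'k) mpoly set)" for j
    by (intro sum_in_max_power mult_left_in_max_power Var_in_max_power)
  then have "(\<Prod>j\<in>Poly_Mapping.keys m. (\<Sum>i\<in>UNIV. Const (g $ i $ j) * Var i) ^ Poly_Mapping.lookup m j)
      \<in> (max_power (mono_deg m) :: ('n, 'k) mpoly set)"
    unfolding mono_deg_def by (intro prod_in_max_power power_in_max_power)
  ultimately show "(\<Prod>j\<in>Poly_Mapping.keys m.
      (\<Sum>i\<in>UNIV. Const (g $ i $ j) * Var i) ^ Poly_Mapping.lookup m j)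
      \<in> (max_power d :: ('n, 'k) mpoly set)"
    by (rule max_power_antimono[rotated])
qed

text \<open>Surjectivity comes from the inverse matrix, which preserves the degree filtration as well.\<close>

lemma lin_change_image_max_power:
  fixes g :: "'k::comm_ring_1^'n^'n"
  assumes "invertible g"
  shows "lin_change g ` max_power d = max_power d"
proof
  show "lin_change g ` max_power d \<subseteq> max_power d"
    by (auto intro: lin_change_in_max_power)
  obtain h where "g ** h = mat 1"
    using assms by (auto simp: invertible_def)
  then have "lin_change g (lin_change h f) = f" for f
    by (simp add: lin_change_lin_change lin_change_mat_1)
  then show "max_power d \<subseteq> lin_change g ` max_power d"
    by (intro subsetI rev_image_eqI[of "lin_change h f" for f]) (simp_all add: lin_change_in_max_power)
qed

section \<open>Ideals given by a space of forms in one degree\<close>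

text \<open>
  This is the ideal \<open>V + \<mm>\<^sup>d\<^sup>+\<^sup>1\<close>, where \<open>V\<close> is the span of \<open>F 0, \<dots>, F (r - 1)\<close> over the coefficient
  ring and \<open>\<mm>\<close> is the ideal generated by the variables. When the \<open>F k\<close> lie in \<open>\<mm>\<^sup>d\<close>, it depends only on
  their parts of degree \<open>d\<close>.
\<close>

definition forms_ideal :: "nat \<Rightarrow> nat \<Rightarrow> (nat \<Rightarrow> ('n, 'k::comm_ring_1) mpoly) \<Rightarrow> ('n, 'k) mpoly set" where
  "forms_ideal d r F = {(\<Sum>k<r. Const (c k) * F k) + h | c h. h \<in> max_power (Suc d)}"

lemma forms_idealI:
  "h \<in> max_power (Suc d) \<Longrightarrow> (\<Sum>k<r. Const (c k) * F k) + h \<in> forms_ideal d r F"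
  by (auto simp: forms_ideal_def)

lemma is_ideal_forms_ideal:
  fixes F :: "nat \<Rightarrow> ('n::finite, 'k::comm_ring_1) mpoly"
  assumes F: "\<And>k. k < r \<Longrightarrow> F k \<in> max_power d"
  shows "is_ideal (forms_ideal d r F)"
  unfolding is_ideal_def module.subspace_def[OF module_times]
proof (intro conjI ballI allI)
  interpret C: comm_ring_hom "Const :: 'k \<Rightarrow> ('n, 'k) mpoly" by (rule comm_ring_hom_Const)
  show "0 \<in> forms_ideal d r F"
    using forms_idealI[of 0 d "\<lambda>_. 0" F r] by (simp add: C.hom_zero)
  fix x assume "x \<in> forms_ideal d r F"
  then obtain c h where x: "x = (\<Sum>k<r. Const (c k) * F k) + h" and h: "h \<in> max_power (Suc d)"
    by (auto simp: forms_ideal_def)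
  {
    fix y assume "y \<in> forms_ideal d r F"
    then obtain c' h' where y: "y = (\<Sum>k<r. Const (c' k) * F k) + h'" and h': "h' \<in> max_power (Suc d)"
      by (auto simp: forms_ideal_def)
    have "x + y = (\<Sum>k<r. Const (c k + c' k) * F k) + (h + h')"
      by (simp add: x y C.hom_add distrib_right sum.distrib)
    then show "x + y \<in> forms_ideal d r F"
      using add_in_max_power[OF h h'] by (simp add: forms_idealI)
  }
  fix p :: "('n, 'k) mpoly"
  \<comment> \<open>Modulo \<open>max_power (Suc d)\<close>, only the constant term of the multiplier acts.\<close>
  define p0 where "p0 = Poly_Mapping.lookup p 0"
  have "p - Const p0 \<in> max_power (Suc 0)"
    unfolding max_power_def
  proof (intro CollectI ballI)
    fix m assume "m \<in> Poly_Mapping.keys (p - Const p0)"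
    then have "m \<noteq> 0" by (auto simp: in_keys_iff lookup_minus Const_def p0_def)
    then show "Suc 0 \<le> mono_deg m" by (metis mono_deg_eq_0 not_less_eq_eq le_zero_eq)
  qed
  then have "(p - Const p0) * (Const (c k) * F k) \<in> max_power (Suc d)" if "k < r" for k
    using mult_in_max_power[of "p - Const p0" "Suc 0" "Const (c k) * F k" d]
      mult_left_in_max_power[OF F[OF that]] by simp
  then have "(\<Sum>k<r. (p - Const p0) * (Const (c k) * F k)) + p * h \<in> max_power (Suc d)"
    using h by (intro add_in_max_power sum_in_max_power mult_left_in_max_power[of h]) simp_all
  moreover have "p * x = (\<Sum>k<r. Const (p0 * c k) * F k)
      + ((\<Sum>k<r. (p - Const p0) * (Const (c k) * F k)) + p * h)"
    by (simp add: x C.hom_mult algebra_simps sum_distrib_left sum_subtractf)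
  ultimately show "p * x \<in> forms_ideal d r F"
    by (simp only: forms_idealI)
qed

lemma lin_change_image_forms_ideal:
  fixes g :: "'k::comm_ring_1^'n^'n"
  assumes "invertible g"
  shows "lin_change g ` forms_ideal d r F = forms_ideal d r (\<lambda>k. lin_change g (F k))"
proof -
  interpret L: comm_ring_hom "lin_change g" by (rule comm_ring_hom_lin_change)
  have *: "lin_change g ((\<Sum>k<r. Const (c k) * F k) + h)
      = (\<Sum>k<r. Const (c k) * lin_change g (F k)) + lin_change g h" for c h
    by (simp add: L.hom_add L.hom_sum L.hom_mult lin_change_Const)
  show ?thesis
  proof (intro equalityI subsetI)
    fix x assume "x \<in> lin_change g ` forms_ideal d r F"
    then show "x \<in> forms_ideal d r (\<lambda>k. lin_change g (F k))"
      by (auto simp: forms_ideal_def[of d r F] * intro!: forms_idealI lin_change_in_max_power)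
  next
    fix x assume "x \<in> forms_ideal d r (\<lambda>k. lin_change g (F k))"
    then obtain c h where "x = (\<Sum>k<r. Const (c k) * lin_change g (F k)) + h"
      and h: "h \<in> max_power (Suc d)"
      by (auto simp: forms_ideal_def)
    moreover obtain h' where "h' \<in> max_power (Suc d)" "h = lin_change g h'"
      using h lin_change_image_max_power[OF assms, of "Suc d"] by blast
    ultimately have "x = lin_change g ((\<Sum>k<r. Const (c k) * F k) + h')"
      by (simp add: *)
    then show "x \<in> lin_change g ` forms_ideal d r F"
      using \<open>h' \<in> max_power (Suc d)\<close> by (blast intro: forms_idealI)
  qed
qed

section \<open>Leading monomials\<close>

lemma lead_mono_works:
  assumes "monomial_order \<tau>" and "f \<noteq> 0"
  shows "lead_mono \<tau> f \<in> Poly_Mapping.keys f"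
    and "\<And>u. u \<in> Poly_Mapping.keys f \<Longrightarrow> u \<noteq> lead_mono \<tau> f \<Longrightarrow> \<tau> (lead_mono \<tau> f) u"
proof -
  let ?P = "\<lambda>m. m \<in> Poly_Mapping.keys f \<and> (\<forall>u\<in>Poly_Mapping.keys f. u \<noteq> m \<longrightarrow> \<tau> m u)"
  have ord: "irreflp \<tau>" "transp \<tau>" "totalp \<tau>"
    using assms(1) by (auto simp: monomial_order_def)
  have "\<exists>m. ?P m"
    using Finite_Set.bex_least_element[of "Poly_Mapping.keys f" \<tau>] assms(2) ord
    by (auto intro: transp_on_subset totalp_on_subset)
  moreover have "m = m'" if "?P m" "?P m'" for m m'
    using that ord by (metis irreflpD transpD)
  ultimately have "\<exists>!m. ?P m" by blast
  from theI'[OF this] show "lead_mono \<tau> f \<in> Poly_Mapping.keys f"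
    and "\<And>u. u \<in> Poly_Mapping.keys f \<Longrightarrow> u \<noteq> lead_mono \<tau> f \<Longrightarrow> \<tau> (lead_mono \<tau> f) u"
    unfolding lead_mono_def by auto
qed

lemma lead_mono_eqI:
  assumes "monomial_order \<tau>" and m: "m \<in> Poly_Mapping.keys f"
    and top: "\<And>u. u \<in> Poly_Mapping.keys f \<Longrightarrow> u \<noteq> m \<Longrightarrow> \<tau> m u"
  shows "lead_mono \<tau> f = m"
proof (rule ccontr)
  assume "lead_mono \<tau> f \<noteq> m"
  moreover have "f \<noteq> 0" using m by auto
  moreover have "irreflp \<tau>" "transp \<tau>"
    using assms(1) by (auto simp: monomial_order_def)
  ultimately show False
    using lead_mono_works[OF assms(1)] m top by (metis irreflpD transpD)
qed

text \<open>
  Indexing both the polynomials and the monomials by numbers below \<open>r\<close> allows one family \<open>F\<close> to be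
  tested against the top monomials of different orders.
\<close>

definition coeff_minor ::
  "nat \<Rightarrow> (nat \<Rightarrow> ('n, 'k::comm_ring_1) mpoly) \<Rightarrow> (nat \<Rightarrow> 'n mono) \<Rightarrow> 'k" where
  "coeff_minor r F b = Determinant.det (Matrix.mat r r (\<lambda>(i, j). Poly_Mapping.lookup (F i) (b j)))"

text \<open>
  Nonsingularity in the two forms needed for elimination: a combination of the \<open>F i\<close> can be chosen
  with prescribed coefficients at the monomials \<open>b j\<close>, and a combination is determined by these
  coefficients. Both follow by multiplying with the adjugate matrix.
\<close>

lemma coeff_minor_nonzero_imp:
  fixes F :: "nat \<Rightarrow> ('n, 'k::field) mpoly"
  assumes "coeff_minor r F b \<noteq> 0" and "l < r"
  shows "\<exists>c. \<forall>j<r. (\<Sum>i<r. c i * Poly_Mapping.lookup (F i) (b j)) = (if j = l then 1 else 0)"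
    (is ?thesis1)
    and "(\<And>j. j < r \<Longrightarrow> (\<Sum>i<r. c i * Poly_Mapping.lookup (F i) (b j)) = 0) \<Longrightarrow> c l = 0"
proof -
  define M where "M = Matrix.mat r r (\<lambda>(i, j). Poly_Mapping.lookup (F i) (b j))"
  define N where "N = adj_mat M"
  define D where "D = Determinant.det M"
  have M: "M \<in> carrier_mat r r" by (simp add: M_def)
  have D: "D \<noteq> 0" using assms(1) by (simp add: D_def M_def coeff_minor_def)
  have N: "N \<in> carrier_mat r r" "M * N = D \<cdot>\<^sub>m 1\<^sub>m r" "N * M = D \<cdot>\<^sub>m 1\<^sub>m r"
    unfolding N_def D_def using adj_mat[OF M] by auto
  have entry: "(\<Sum>k<r. (A $$ (i, k)) * (B $$ (k, j))) = (A * B) $$ (i, j)"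
    if "A \<in> carrier_mat r r" "B \<in> carrier_mat r r" "i < r" "j < r" for A B :: "'k mat" and i j
    using that by (simp add: scalar_prod_def atLeast0LessThan)
  have NM: "(\<Sum>k<r. (N $$ (i, k)) * Poly_Mapping.lookup (F k) (b j)) = (if i = j then D else 0)"
    if "i < r" "j < r" for i j
    using entry[OF N(1) M that] that by (auto simp: N(3)) (auto simp: M_def)
  have MN: "(\<Sum>k<r. Poly_Mapping.lookup (F i) (b k) * (N $$ (k, j))) = (if i = j then D else 0)"
    if "i < r" "j < r" for i j
    using entry[OF M N(1) that] that by (auto simp: N(2)) (auto simp: M_def)
  show ?thesis1
  proof (intro exI[of _ "\<lambda>k. (N $$ (l, k)) / D"] allI impI)
    fix j assume j: "j < r"
    have "(\<Sum>i<r. (N $$ (l, i)) / D * Poly_Mapping.lookup (F i) (b j))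
        = (\<Sum>i<r. (N $$ (l, i)) * Poly_Mapping.lookup (F i) (b j)) / D"
      by (simp add: sum_divide_distrib)
    then show "(\<Sum>i<r. (N $$ (l, i)) / D * Poly_Mapping.lookup (F i) (b j)) = (if j = l then 1 else 0)"
      using D NM[OF assms(2) j] by auto
  qed
  assume 0: "\<And>j. j < r \<Longrightarrow> (\<Sum>i<r. c i * Poly_Mapping.lookup (F i) (b j)) = 0"
  have "0 = (\<Sum>j<r. (\<Sum>i<r. c i * Poly_Mapping.lookup (F i) (b j)) * (N $$ (j, l)))"
    by (simp add: 0)
  also have "\<dots> = (\<Sum>j<r. \<Sum>i<r. c i * (Poly_Mapping.lookup (F i) (b j) * (N $$ (j, l))))"
    by (simp add: sum_distrib_right mult.assoc)
  also have "\<dots> = (\<Sum>i<r. \<Sum>j<r. c i * (Poly_Mapping.lookup (F i) (b j) * (N $$ (j, l))))"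
    by (rule sum.swap)
  also have "\<dots> = (\<Sum>i<r. c i * (if i = l then D else 0))"
    by (rule sum.cong) (simp_all add: sum_distrib_left[symmetric] MN assms(2))
  also have "\<dots> = c l * D"
    using assms(2) by (simp add: if_distrib sum.delta cong: if_cong)
  finally show "c l = 0" using D by simp
qed

text \<open>
  A polynomial of the ideal whose leading monomial has degree \<open>d\<close> outside the top segment \<open>b\<close> would have
  zero coefficients at all of \<open>b\<close>; by nonsingularity its part in the span of \<open>F\<close> would then vanish.
  Conversely, elimination produces for each \<open>b l\<close> an element whose only monomial in the segment is \<open>b l\<close>.
\<close>

lemma lead_monos_forms_ideal:
  fixes F :: "nat \<Rightarrow> ('n::{finite, linorder}, 'k::field) mpoly"
  assumes \<tau>: "monomial_order \<tau>"
    and F: "\<And>k. k < r \<Longrightarrow> F k \<in> max_power d"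
    and deg: "\<And>k. k < r \<Longrightarrow> mono_deg (b k) = d"
    and top: "\<And>k y. k < r \<Longrightarrow> mono_deg y = d \<Longrightarrow> y \<notin> b ` {..<r} \<Longrightarrow> \<tau> (b k) y"
    and minor: "coeff_minor r F b \<noteq> 0"
  shows "{lead_mono \<tau> f | f. f \<in> forms_ideal d r F \<and> f \<noteq> 0} = b ` {..<r} \<union> {m. d < mono_deg m}"
proof (intro equalityI subsetI)
  have graded: "\<tau> u v" if "mono_deg v < mono_deg u" for u v
    using \<tau> that by (auto simp: monomial_order_def)
  have asym: "\<not> \<tau> v u" if "\<tau> u v" for u v
    using \<tau> that by (metis irreflpD transpD monomial_order_def)
  have high: "Poly_Mapping.lookup h m = 0" if "h \<in> max_power (Suc d)" "mono_deg m = d"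
    for h :: "('n, 'k) mpoly" and m
    using that by (auto simp: max_power_def simp flip: not_in_keys_iff_lookup_eq_zero)
  {
    fix m assume "m \<in> {lead_mono \<tau> f | f. f \<in> forms_ideal d r F \<and> f \<noteq> 0}"
    then obtain f where f: "f \<in> forms_ideal d r F" "f \<noteq> 0" and m: "m = lead_mono \<tau> f" by blast
    obtain c h where fc: "f = (\<Sum>k<r. Const (c k) * F k) + h" and h: "h \<in> max_power (Suc d)"
      using f(1) by (auto simp: forms_ideal_def)
    note lead = lead_mono_works[OF \<tau> f(2), folded m]
    have "f \<in> max_power d"
      unfolding fc using h F
      by (intro add_in_max_power sum_in_max_power mult_left_in_max_power)
        (auto intro: max_power_antimono)
    then have "d \<le> mono_deg m" using lead(1) by (simp add: max_power_def)
    have "m \<in> b ` {..<r}" if md: "mono_deg m = d"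
    proof (rule ccontr)
      assume notin: "m \<notin> b ` {..<r}"
      have "Poly_Mapping.lookup f (b j) = 0" if "j < r" for j
      proof (rule ccontr)
        assume "Poly_Mapping.lookup f (b j) \<noteq> 0"
        then have "b j \<in> Poly_Mapping.keys f" by (simp add: in_keys_iff)
        then have "\<tau> m (b j)" using lead(2) notin that by auto
        moreover have "\<tau> (b j) m" using top that md notin by blast
        ultimately show False using asym by blast
      qed
      then have "(\<Sum>i<r. c i * Poly_Mapping.lookup (F i) (b j)) = 0" if "j < r" for j
        using that high[OF h deg] by (simp add: fc lookup_add lookup_sum lookup_Const_mult)
      then have "c k = 0" if "k < r" for k
        using coeff_minor_nonzero_imp(2)[OF minor that] by blast
      then have "Poly_Mapping.lookup f m = 0"
        using high[OF h md] by (simp add: fc lookup_add lookup_sum lookup_Const_mult)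
      then show False using lead(1) by (simp add: in_keys_iff)
    qed
    then show "m \<in> b ` {..<r} \<union> {m. d < mono_deg m}"
      using \<open>d \<le> mono_deg m\<close> by (cases "mono_deg m = d") auto
  }
  fix m assume "m \<in> b ` {..<r} \<union> {m. d < mono_deg m}"
  then consider l where "l < r" "m = b l" | "d < mono_deg m" by blast
  then show "m \<in> {lead_mono \<tau> f | f. f \<in> forms_ideal d r F \<and> f \<noteq> 0}"
  proof cases
    case 1
    obtain c where c: "\<And>j. j < r \<Longrightarrow>
        (\<Sum>i<r. c i * Poly_Mapping.lookup (F i) (b j)) = (if j = l then 1 else 0)"
      using coeff_minor_nonzero_imp(1)[OF minor 1(1)] by blast
    define f0 where "f0 = (\<Sum>k<r. Const (c k) * F k)"
    \<comment> \<open>Terms of degree above \<open>d\<close> would dominate \<open>b l\<close>, so they are cut off; the difference stays in the ideal.\<close>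
    define f where "f = (\<Sum>u\<in>{u \<in> Poly_Mapping.keys f0. mono_deg u = d}.
        Poly_Mapping.single u (Poly_Mapping.lookup f0 u))"
    have lf: "Poly_Mapping.lookup f u = (if mono_deg u = d then Poly_Mapping.lookup f0 u else 0)" for u
      by (auto simp: f_def lookup_sum lookup_single when_def in_keys_iff sum.delta)
    have "f0 \<in> max_power d"
      unfolding f0_def by (intro sum_in_max_power mult_left_in_max_power F) simp
    have "f - f0 \<in> max_power (Suc d)"
      unfolding max_power_def
    proof (intro CollectI ballI)
      fix u assume "u \<in> Poly_Mapping.keys (f - f0)"
      then have "mono_deg u \<noteq> d" "u \<in> Poly_Mapping.keys f0"
        by (auto simp: in_keys_iff lookup_minus lf split: if_splits)
      with \<open>f0 \<in> max_power d\<close> show "Suc d \<le> mono_deg u"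
        by (simp add: max_power_def le_neq_implies_less Suc_leI)
    qed
    from forms_idealI[OF this, of c F r] have "f \<in> forms_ideal d r F"
      by (simp flip: f0_def)
    have fb: "Poly_Mapping.lookup f (b j) = (if j = l then 1 else 0)" if "j < r" for j
      using c[OF that] by (simp add: lf deg that f0_def lookup_sum lookup_Const_mult)
    have mk: "m \<in> Poly_Mapping.keys f"
      using fb[OF 1(1)] by (simp add: 1 in_keys_iff)
    have "lead_mono \<tau> f = m"
    proof (rule lead_mono_eqI[OF \<tau> mk])
      fix u assume u: "u \<in> Poly_Mapping.keys f" "u \<noteq> m"
      then have "mono_deg u = d" by (auto simp: in_keys_iff lf split: if_splits)
      moreover have "u \<notin> b ` {..<r}"
        using u fb by (auto simp: in_keys_iff 1 split: if_splits)
      ultimately show "\<tau> m u" using top 1 by blast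
    qed
    then show ?thesis using \<open>f \<in> forms_ideal d r F\<close> mk by auto
  next
    case 2
    let ?f = "Poly_Mapping.single m 1 :: ('n, 'k) mpoly"
    have "lead_mono \<tau> ?f = m" by (rule lead_mono_eqI[OF \<tau>]) auto
    moreover have "?f \<in> forms_ideal d r F"
      using forms_idealI[of ?f d "\<lambda>_. 0" F r] 2 by (simp add: max_power_def Const_def)
    moreover have "?f \<noteq> 0" by (simp flip: keys_eq_empty)
    ultimately show ?thesis by (auto intro!: exI[of _ ?f])
  qed
qed


section \<open>Zariski open sets of invertible matrices\<close>

lemma (in comm_ring_hom) hom_det_cartesian:
  "Determinants.det (\<chi> i j. hom (A $ i $ j)) = hom (Determinants.det A)"
  by (simp add: Determinants.det_def hom_sum hom_mult hom_prod hom_of_int)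

lemma comm_ring_hom_poly: "comm_ring_hom (\<lambda>p. poly p (t :: 'k::comm_ring_1))"
  by unfold_locales auto

text \<open>
  On the line \<open>g + t (h - g)\<close> through a point \<open>g\<close> of \<open>U\<close> and a point \<open>h\<close> of \<open>V\<close>, the polynomials that
  witness membership and the determinant become nonzero univariate polynomials in \<open>t\<close>. Their product
  has finitely many roots, so some point of the line lies in both sets.
\<close>

lemma zariski_open_GL_inter:
  fixes U V :: "('k::field^'n^'n) set"
  assumes inf: "infinite (UNIV :: 'k set)"
    and U: "zariski_open_GL U" "U \<noteq> {}" and V: "zariski_open_GL V" "V \<noteq> {}"
  shows "U \<inter> V \<noteq> {}"
proof -
  obtain P Q :: "('n \<times> 'n, 'k) mpoly set"
    where UP: "U = {g. invertible g \<and> (\<exists>p\<in>P. subst_hom id (\<lambda>(i, j). g $ i $ j) p \<noteq> 0)}"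
      and VQ: "V = {g. invertible g \<and> (\<exists>p\<in>Q. subst_hom id (\<lambda>(i, j). g $ i $ j) p \<noteq> 0)}"
    using U(1) V(1) unfolding zariski_open_GL_def by blast
  obtain g p where g: "invertible g" "p \<in> P" "subst_hom id (\<lambda>(i, j). g $ i $ j) p \<noteq> 0"
    using U(2) unfolding UP by blast
  obtain h q where h: "invertible h" "q \<in> Q" "subst_hom id (\<lambda>(i, j). h $ i $ j) q \<noteq> 0"
    using V(2) unfolding VQ by blast
  define line :: "'k \<Rightarrow> 'k^'n^'n" where "line t = (\<chi> i j. g $ i $ j + t * (h $ i $ j - g $ i $ j))" for t
  define G :: "'k poly^'n^'n" where "G = (\<chi> i j. [:g $ i $ j, h $ i $ j - g $ i $ j:])"
  define R where "R = (\<lambda>p. subst_hom (\<lambda>c. [:c:]) (\<lambda>(i, j). G $ i $ j) (p :: ('n \<times> 'n, 'k) mpoly))"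
  have eval: "poly (R p) t = subst_hom id (\<lambda>(i, j). line t $ i $ j) p" for p t
    unfolding R_def
    by (simp add: comm_ring_hom.hom_subst_hom[OF comm_ring_hom_poly] G_def line_def
        case_prod_unfold id_def)
  have eval_det: "poly (Determinants.det G) t = Determinants.det (line t)" for t
    by (simp add: comm_ring_hom.hom_det_cartesian[OF comm_ring_hom_poly, symmetric] G_def line_def)
  have ends: "line 0 = g" "line 1 = h"
    by (simp_all add: line_def vec_eq_iff)
  define T where "T = R p * R q * Determinants.det G"
  have "R p \<noteq> 0" using g(3) eval[of p 0] by (auto simp: ends)
  moreover have "R q \<noteq> 0" using h(3) eval[of q 1] by (auto simp: ends)
  moreover have "Determinants.det G \<noteq> 0"
    using g(1) eval_det[of 0] by (auto simp: ends invertible_det_nz)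
  ultimately have "T \<noteq> 0" by (simp add: T_def)
  then have "finite {t. poly T t = 0}" by (rule poly_roots_finite)
  then obtain t where "poly T t \<noteq> 0"
    using ex_new_if_finite[OF inf] by blast
  then have "line t \<in> U \<inter> V"
    unfolding UP VQ using g(2) h(2) by (auto simp: T_def eval eval_det invertible_det_nz)
  then show ?thesis by blast
qed

lemma coeff_minor_hom:
  assumes "comm_ring_hom h"
    and "\<And>i j. i < r \<Longrightarrow> j < r \<Longrightarrow>
      h (Poly_Mapping.lookup (F i) (b j)) = Poly_Mapping.lookup (F' i) (b j)"
  shows "h (coeff_minor r F b) = coeff_minor r F' b"
proof -
  interpret comm_ring_hom h by (rule assms(1))
  have "map_mat h (Matrix.mat r r (\<lambda>(i, j). Poly_Mapping.lookup (F i) (b j)))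
      = Matrix.mat r r (\<lambda>(i, j). Poly_Mapping.lookup (F' i) (b j))"
    by (rule eq_matI) (auto simp: assms(2))
  then show ?thesis by (simp add: coeff_minor_def flip: hom_det)
qed

text \<open>
  The defining polynomial is the same minor for the generic coordinate change, in which the matrix
  entries are indeterminates of the coefficient ring. Evaluating these indeterminates at the entries
  of \<open>g\<close> is a ring homomorphism, so it commutes with taking coefficients and the determinant.
\<close>

lemma zariski_open_coeff_minor:
  fixes F :: "nat \<Rightarrow> ('n::finite, 'k::comm_ring_1) mpoly"
  shows "zariski_open_GL {g. invertible g \<and> coeff_minor r (\<lambda>k. lin_change g (F k)) b \<noteq> 0}"
proof -
  define generic :: "('n, 'k) mpoly \<Rightarrow> ('n, ('n \<times> 'n, 'k) mpoly) mpoly"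
    where "generic = subst_hom (\<lambda>c. Const (Const c)) (\<lambda>j. \<Sum>i\<in>UNIV. Const (Var (i, j)) * Var i)"
  have coeff: "subst_hom id (\<lambda>(i, j). g $ i $ j) (Poly_Mapping.lookup (generic f) m)
      = Poly_Mapping.lookup (lin_change g f) m" for g f m
  proof -
    let ?ev = "subst_hom id (\<lambda>(i, j). g $ i $ j) :: ('n \<times> 'n, 'k) mpoly \<Rightarrow> 'k"
    let ?H = "subst_hom (\<lambda>c. Const (?ev c)) Var :: ('n, ('n \<times> 'n, 'k) mpoly) mpoly \<Rightarrow> ('n, 'k) mpoly"
    have "comm_ring_hom (id :: 'k \<Rightarrow> 'k)" by unfold_locales auto
    then interpret ev: comm_ring_hom ?ev by (rule comm_ring_hom.comm_ring_hom_subst_hom)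
    interpret C: comm_ring_hom "Const :: 'k \<Rightarrow> ('n, 'k) mpoly" by (rule comm_ring_hom_Const)
    have "comm_ring_hom (\<lambda>c. Const (?ev c) :: ('n, 'k) mpoly)"
      by unfold_locales (simp_all add: C.hom_add C.hom_mult ev.hom_add ev.hom_mult)
    then interpret H: comm_ring_hom ?H by (rule comm_ring_hom.comm_ring_hom_subst_hom)
    have "?H (generic f) = lin_change g f"
      unfolding generic_def lin_change_def
      by (simp add: H.hom_subst_hom H.hom_sum H.hom_mult subst_hom_Const subst_hom_Var)
    moreover have "Poly_Mapping.lookup (?H (generic f)) m = ?ev (Poly_Mapping.lookup (generic f) m)"
      by (rule lookup_subst_hom_Const_Var) simp
    ultimately show ?thesis by simp
  qed
  have "subst_hom id (\<lambda>(i, j). g $ i $ j) (coeff_minor r (\<lambda>k. generic (F k)) b)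
      = coeff_minor r (\<lambda>k. lin_change g (F k)) b" for g
  proof (rule coeff_minor_hom)
    have "comm_ring_hom (id :: 'k \<Rightarrow> 'k)" by unfold_locales auto
    then show "comm_ring_hom (subst_hom id (\<lambda>(i, j). g $ i $ j) :: ('n \<times> 'n, 'k) mpoly \<Rightarrow> 'k)"
      by (rule comm_ring_hom.comm_ring_hom_subst_hom)
  qed (rule coeff)
  then show ?thesis
    unfolding zariski_open_GL_def
    by (intro exI[of _ "{coeff_minor r (\<lambda>k. generic (F k)) b}"]) simp
qed

section \<open>Generic initial ideals\<close>

lemma initial_ideal_eq:
  "initial_ideal \<tau> I
    = ideal_gen ((\<lambda>m. Poly_Mapping.single m 1) ` {lead_mono \<tau> f | f. f \<in> I \<and> f \<noteq> 0})"
  unfolding initial_ideal_def by (rule arg_cong[of _ _ ideal_gen]) blast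

lemma gin_eqI:
  fixes I :: "('n::finite, 'k::field) mpoly set"
  assumes inf: "infinite (UNIV :: 'k set)"
    and U: "zariski_open_GL U" "U \<noteq> {}"
    and J: "\<And>g :: 'k^'n^'n. g \<in> U \<Longrightarrow> initial_ideal \<tau> (lin_change g ` I) = J"
  shows "gin \<tau> I = J"
  unfolding gin_def
proof (rule the_equality)
  show "\<exists>U :: ('k^'n^'n) set. zariski_open_GL U \<and> U \<noteq> {} \<and>
      (\<forall>g\<in>U. initial_ideal \<tau> (lin_change g ` I) = J)"
    using U J by blast
  fix J' assume "\<exists>U :: ('k^'n^'n) set. zariski_open_GL U \<and> U \<noteq> {} \<and>
      (\<forall>g\<in>U. initial_ideal \<tau> (lin_change g ` I) = J')"
  then obtain U' :: "('k^'n^'n) set" where U': "zariski_open_GL U'" "U' \<noteq> {}"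
    and J': "\<And>g. g \<in> U' \<Longrightarrow> initial_ideal \<tau> (lin_change g ` I) = J'" by blast
  from zariski_open_GL_inter[OF inf U U'] obtain g where "g \<in> U" "g \<in> U'" by blast
  with J[of g] J'[of g] show "J' = J" by simp
qed

lemma invertible_mat_1: "invertible (mat 1 :: 'k::field^'n^'n)"
  by (simp add: invertible_det_nz)

text \<open>
  The coordinate changes for which the transformed minor is nonzero form a Zariski open set, on which
  the initial ideal is constant; the hypothesis on \<open>F\<close> itself says that this set contains the identity.
\<close>

lemma gin_forms_ideal:
  fixes F :: "nat \<Rightarrow> ('n::{finite, linorder}, 'k::field) mpoly"
  assumes inf: "infinite (UNIV :: 'k set)"
    and \<tau>: "monomial_order \<tau>"
    and F: "\<And>k. k < r \<Longrightarrow> F k \<in> max_power d"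
    and deg: "\<And>k. k < r \<Longrightarrow> mono_deg (b k) = d"
    and top: "\<And>k y. k < r \<Longrightarrow> mono_deg y = d \<Longrightarrow> y \<notin> b ` {..<r} \<Longrightarrow> \<tau> (b k) y"
    and minor: "coeff_minor r F b \<noteq> 0"
  shows "gin \<tau> (forms_ideal d r F)
    = ideal_gen ((\<lambda>m. Poly_Mapping.single m 1) ` (b ` {..<r} \<union> {m. d < mono_deg m}))"
proof (rule gin_eqI[OF inf])
  let ?U = "{g. invertible g \<and> coeff_minor r (\<lambda>k. lin_change g (F k)) b \<noteq> 0}"
  show "zariski_open_GL ?U" by (rule zariski_open_coeff_minor)
  have "mat 1 \<in> ?U"
    using minor by (simp add: lin_change_mat_1 invertible_mat_1)
  then show "?U \<noteq> {}" by blast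
  fix g assume g: "g \<in> ?U"
  have "lin_change g ` forms_ideal d r F = forms_ideal d r (\<lambda>k. lin_change g (F k))"
    using g by (simp add: lin_change_image_forms_ideal)
  moreover have "{lead_mono \<tau> f | f. f \<in> forms_ideal d r (\<lambda>k. lin_change g (F k)) \<and> f \<noteq> 0}
      = b ` {..<r} \<union> {m. d < mono_deg m}"
    using g by (intro lead_monos_forms_ideal[OF \<tau> _ deg top])
      (auto intro: lin_change_in_max_power F)
  ultimately show "initial_ideal \<tau> (lin_change g ` forms_ideal d r F)
      = ideal_gen ((\<lambda>m. Poly_Mapping.single m 1) ` (b ` {..<r} \<union> {m. d < mono_deg m}))"
    by (simp add: initial_ideal_eq)
qed

text \<open>
  The polynomials in \<open>\<mm>\<^sup>d\<close> without the monomial \<open>u\<close> form an ideal, since a multiple of a monomial of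
  degree at least \<open>d\<close> can only be \<open>u\<close> if it is the trivial multiple of \<open>u\<close>. This ideal contains all
  generators when \<open>u\<close> is not one of them.
\<close>

lemma single_in_ideal_gen_iff:
  fixes u :: "'n::finite mono"
  assumes u: "mono_deg u = d" and B: "\<And>m. m \<in> B \<Longrightarrow> mono_deg m = d"
  shows "(Poly_Mapping.single u 1 :: ('n, 'k::comm_ring_1) mpoly)
      \<in> ideal_gen ((\<lambda>m. Poly_Mapping.single m 1) ` (B \<union> {m. d < mono_deg m})) \<longleftrightarrow> u \<in> B"
proof
  assume "u \<in> B"
  then show "(Poly_Mapping.single u 1 :: ('n, 'k) mpoly)
      \<in> ideal_gen ((\<lambda>m. Poly_Mapping.single m 1) ` (B \<union> {m. d < mono_deg m}))"
    unfolding ideal_gen_def by (intro module.span_base[OF module_times] imageI UnI1)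
next
  define S :: "('n, 'k) mpoly set" where "S = {f \<in> max_power d. u \<notin> Poly_Mapping.keys f}"
  assume in_gen: "(Poly_Mapping.single u 1 :: ('n, 'k) mpoly)
      \<in> ideal_gen ((\<lambda>m. Poly_Mapping.single m 1) ` (B \<union> {m. d < mono_deg m}))"
  show "u \<in> B"
  proof (rule ccontr)
    assume "u \<notin> B"
    have "module.subspace (*) S"
      unfolding module.subspace_def[OF module_times]
    proof (intro conjI ballI allI)
      show "0 \<in> S" by (simp add: S_def)
      fix x assume x: "x \<in> S"
      show "x + y \<in> S" if "y \<in> S" for y
        using x that keys_add[of x y] by (auto simp: S_def add_in_max_power)
      fix p :: "('n, 'k) mpoly"
      have "u \<notin> Poly_Mapping.keys (p * x)"
      proof
        assume "u \<in> Poly_Mapping.keys (p * x)"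
        then obtain a m where m: "u = a + m" "m \<in> Poly_Mapping.keys x"
          using keys_mult[of p x] by blast
        moreover have "d \<le> mono_deg m" using m(2) x by (simp add: S_def max_power_def)
        moreover have "mono_deg a + mono_deg m = d" using u m(1) mono_deg_add by metis
        ultimately have "mono_deg a = 0" by linarith
        then have "a = 0" by (simp only: mono_deg_eq_0)
        then have "u = m" using m(1) by simp
        with m(2) x show False by (simp add: S_def)
      qed
      then show "p * x \<in> S" using x by (simp add: S_def mult_left_in_max_power)
    qed
    moreover have "(\<lambda>m. Poly_Mapping.single m 1) ` (B \<union> {m. d < mono_deg m}) \<subseteq> S"
    proof (rule image_subsetI)
      fix m assume "m \<in> B \<union> {m. d < mono_deg m}"
      then have "d \<le> mono_deg m" "m \<noteq> u"
        using B[of m] u \<open>u \<notin> B\<close> by auto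
      then show "Poly_Mapping.single m 1 \<in> S" by (simp add: S_def max_power_def)
    qed
    ultimately have "ideal_gen ((\<lambda>m. Poly_Mapping.single m 1) ` (B \<union> {m. d < mono_deg m})) \<subseteq> S"
      unfolding ideal_gen_def by (intro module.span_minimal[OF module_times])
    with in_gen show False by (auto simp: S_def)
  qed
qed

section \<open>Separating two monomial orders\<close>

definition separating_form :: "nat \<Rightarrow> (nat \<Rightarrow> 'n mono) \<Rightarrow> 'n mono \<Rightarrow> 'n mono \<Rightarrow> nat \<Rightarrow> ('n, 'k::comm_ring_1) mpoly"
  where "separating_form a e u v k = (if k < a then Poly_Mapping.single (e k) 1
    else Poly_Mapping.single u 1 + Poly_Mapping.single v 1)"

lemma separating_form_commute: "separating_form a e u v = separating_form a e v u"
  by (simp add: separating_form_def fun_eq_iff add.commute)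

lemma separating_form_in_max_power:
  fixes e :: "nat \<Rightarrow> 'n mono"
  assumes "\<And>k. k < a \<Longrightarrow> mono_deg (e k) = d" "mono_deg u = d" "mono_deg v = d"
  shows "separating_form a e u v k \<in> (max_power d :: ('n, 'k::comm_ring_1) mpoly set)"
proof -
  have single: "Poly_Mapping.single m 1 \<in> (max_power d :: ('n, 'k) mpoly set)"
    if "mono_deg m = d" for m :: "'n mono"
    using that by (simp add: max_power_def)
  show ?thesis
    unfolding separating_form_def by (auto intro!: add_in_max_power single assms)
qed

text \<open>
  The coefficients of the monomials of \<open>A\<close> and of \<open>u + v\<close> at the top segment \<open>A \<union> {u}\<close> form the
  identity matrix. The form \<open>u + v\<close> is symmetric, so the same ideal can be used with \<open>u\<close> and \<open>v\<close>
  exchanged for an order in which \<open>v\<close> comes next after \<open>A\<close>.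
\<close>

lemma mem_gin_separating:
  fixes u v :: "'n::{finite, linorder} mono" and e :: "nat \<Rightarrow> 'n mono"
  assumes inf: "infinite (UNIV :: 'k::field set)"
    and \<tau>: "monomial_order \<tau>"
    and e: "inj_on e {..<a}" "\<And>k. k < a \<Longrightarrow> mono_deg (e k) = d"
    and u: "mono_deg u = d" "u \<notin> e ` {..<a}" and v: "mono_deg v = d" "v \<notin> e ` {..<a}"
    and neq: "u \<noteq> v"
    and top_e: "\<And>k y. k < a \<Longrightarrow> mono_deg y = d \<Longrightarrow> y \<notin> e ` {..<a} \<Longrightarrow> \<tau> (e k) y"
    and top_u: "\<And>y. mono_deg y = d \<Longrightarrow> y \<notin> e ` {..<a} \<Longrightarrow> y \<noteq> u \<Longrightarrow> \<tau> u y"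
    and w: "mono_deg w = d"
  shows "(Poly_Mapping.single w 1 :: ('n, 'k) mpoly)
    \<in> gin \<tau> (forms_ideal d (Suc a) (separating_form a e u v)) \<longleftrightarrow> w \<in> insert u (e ` {..<a})"
proof -
  define b where "b k = (if k < a then e k else u)" for k
  let ?F = "separating_form a e u v :: nat \<Rightarrow> ('n, 'k) mpoly"
  have image_b: "b ` {..<Suc a} = insert u (e ` {..<a})"
    by (auto simp: b_def lessThan_Suc)
  have "Matrix.mat (Suc a) (Suc a) (\<lambda>(i, j). Poly_Mapping.lookup (?F i) (b j)) = 1\<^sub>m (Suc a)"
  proof (rule eq_matI)
    fix i j assume "i < dim_row (1\<^sub>m (Suc a) :: 'k mat)" "j < dim_col (1\<^sub>m (Suc a) :: 'k mat)"
    then have ij: "i < Suc a" "j < Suc a" by simp_all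
    have "Poly_Mapping.lookup (?F i) (b j) = (if i = j then 1 else 0)"
    proof (cases "i < a"; cases "j < a")
      assume "i < a" "j < a"
      then show ?thesis
        using e(1) by (auto simp: separating_form_def b_def lookup_single when_def inj_on_eq_iff)
    next
      assume "i < a" "\<not> j < a"
      then show ?thesis
        using u(2) by (auto simp: separating_form_def b_def lookup_single when_def)
    next
      assume "\<not> i < a" "j < a"
      then show ?thesis
        using u(2) v(2) by (auto simp: separating_form_def b_def lookup_single lookup_add when_def)
    next
      assume "\<not> i < a" "\<not> j < a"
      then show ?thesis
        using ij neq by (auto simp: separating_form_def b_def lookup_single lookup_add when_def)
    qed
    then show "Matrix.mat (Suc a) (Suc a) (\<lambda>(i, j). Poly_Mapping.lookup (?F i) (b j)) $$ (i, j)
        = 1\<^sub>m (Suc a) $$ (i, j)"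
      using ij by simp
  qed simp_all
  then have minor: "coeff_minor (Suc a) ?F b \<noteq> 0"
    by (simp add: coeff_minor_def)
  have gin: "gin \<tau> (forms_ideal d (Suc a) ?F)
    = ideal_gen ((\<lambda>m. Poly_Mapping.single m 1) ` (b ` {..<Suc a} \<union> {m. d < mono_deg m}))"
  proof (rule gin_forms_ideal[OF inf \<tau> _ _ _ minor])
    show "?F k \<in> max_power d" for k
      using e(2) u(1) v(1) by (rule separating_form_in_max_power)
    show "mono_deg (b k) = d" if "k < Suc a" for k
      using e(2) u(1) by (simp add: b_def)
    show "\<tau> (b k) y" if "k < Suc a" "mono_deg y = d" "y \<notin> b ` {..<Suc a}" for k y
      using that(2,3) top_e top_u unfolding image_b by (auto simp: b_def)
  qed
  have "mono_deg m = d" if "m \<in> insert u (e ` {..<a})" for m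
    using that e(2) u(1) by auto
  then show ?thesis
    unfolding gin image_b by (rule single_in_ideal_gen_iff[OF w])
qed

text \<open>
  Take for \<open>u\<close> the \<open>\<tau>\<^sub>1\<close>-largest monomial that takes part as the \<open>\<tau>\<^sub>1\<close>-larger one in a disagreement,
  and for \<open>A\<close> the monomials that are \<open>\<tau>\<^sub>1\<close>-larger than \<open>u\<close>. By maximality no element of \<open>A\<close> takes part
  in this way, which makes \<open>A\<close> an initial segment for \<open>\<tau>\<^sub>2\<close>, too. But \<open>u\<close> is not the
  \<open>\<tau>\<^sub>2\<close>-largest monomial after \<open>A\<close>, because of the disagreement.
\<close>

lemma monomial_orders_separation:
  fixes \<tau>\<^sub>1 \<tau>\<^sub>2 :: "'n::{finite, linorder} mono \<Rightarrow> 'n mono \<Rightarrow> bool"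
  assumes o1: "monomial_order \<tau>\<^sub>1" and o2: "monomial_order \<tau>\<^sub>2" and neq: "\<tau>\<^sub>1 \<noteq> \<tau>\<^sub>2"
  obtains A d u v where "A \<subseteq> {m. mono_deg m = d}"
    "mono_deg u = d" "u \<notin> A" "mono_deg v = d" "v \<notin> A" "u \<noteq> v"
    "\<And>x y. x \<in> A \<Longrightarrow> mono_deg y = d \<Longrightarrow> y \<notin> A \<Longrightarrow> \<tau>\<^sub>1 x y \<and> \<tau>\<^sub>2 x y"
    "\<And>y. mono_deg y = d \<Longrightarrow> y \<notin> A \<Longrightarrow> y \<noteq> u \<Longrightarrow> \<tau>\<^sub>1 u y"
    "\<And>y. mono_deg y = d \<Longrightarrow> y \<notin> A \<Longrightarrow> y \<noteq> v \<Longrightarrow> \<tau>\<^sub>2 v y"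
proof -
  have p1: "irreflp \<tau>\<^sub>1" "transp \<tau>\<^sub>1" "totalp \<tau>\<^sub>1" and p2: "irreflp \<tau>\<^sub>2" "transp \<tau>\<^sub>2" "totalp \<tau>\<^sub>2"
    using o1 o2 by (auto simp: monomial_order_def)
  have graded: "\<tau>\<^sub>1 x y" "\<tau>\<^sub>2 x y" if "mono_deg y < mono_deg x" for x y
    using o1 o2 that by (auto simp: monomial_order_def)
  have total: "\<tau>\<^sub>1 x y \<or> \<tau>\<^sub>1 y x" "\<tau>\<^sub>2 x y \<or> \<tau>\<^sub>2 y x" if "x \<noteq> y" for x y
    using p1(3) p2(3) that by (auto dest: totalpD)
  have asym: "\<not> (\<tau>\<^sub>1 x y \<and> \<tau>\<^sub>1 y x)" "\<not> (\<tau>\<^sub>2 x y \<and> \<tau>\<^sub>2 y x)" for x y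
    using p1 p2 by (meson irreflpD transpD)+
  have irr: "\<not> \<tau>\<^sub>1 x x" "\<not> \<tau>\<^sub>2 x x" for x
    using asym by blast+
  obtain x0 y0 where xy0: "\<tau>\<^sub>1 x0 y0" "\<tau>\<^sub>2 y0 x0"
  proof -
    obtain x y where "\<tau>\<^sub>1 x y \<noteq> \<tau>\<^sub>2 x y" using neq by blast
    moreover from this have "x \<noteq> y" using irr by metis
    ultimately show ?thesis using that total[of x y] asym[of x y] by blast
  qed
  define d where "d = mono_deg x0"
  have d: "mono_deg y0 = d"
  proof (rule ccontr)
    assume "mono_deg y0 \<noteq> d"
    then consider "mono_deg y0 < mono_deg x0" | "mono_deg x0 < mono_deg y0"
      unfolding d_def by linarith
    then show False
    proof cases
      case 1
      then show False using graded(2) xy0(2) asym(2) by blast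
    next
      case 2
      then show False using graded(1) xy0(1) asym(1) by blast
    qed
  qed
  define D where "D = {m :: 'n mono. mono_deg m = d}"
  define X where "X = {x \<in> D. \<exists>y\<in>D. \<tau>\<^sub>1 x y \<and> \<tau>\<^sub>2 y x}"
  have finD: "finite D" unfolding D_def by (rule finite_mono_deg_eq)
  have "x0 \<in> X" using xy0 d by (auto simp: X_def D_def d_def)
  then obtain u where u: "u \<in> X" "\<And>x. x \<in> X \<Longrightarrow> x \<noteq> u \<Longrightarrow> \<tau>\<^sub>1 u x"
    using Finite_Set.bex_least_element[of X \<tau>\<^sub>1] finD p1
    by (auto simp: X_def intro: transp_on_subset totalp_on_subset)
  obtain y1 where y1: "y1 \<in> D" "\<tau>\<^sub>1 u y1" "\<tau>\<^sub>2 y1 u" using u(1) by (auto simp: X_def)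
  define A where "A = {x \<in> D. \<tau>\<^sub>1 x u}"
  have uD: "u \<in> D" using u(1) by (simp add: X_def)
  have uA: "u \<notin> A" using irr by (simp add: A_def)
  have AX: "x \<notin> X" if "x \<in> A" for x
  proof
    assume "x \<in> X"
    moreover have "\<tau>\<^sub>1 x u" using that by (simp add: A_def)
    moreover from this have "x \<noteq> u" using irr(1) by blast
    ultimately show False using u(2) asym(1) by blast
  qed
  have top1: "\<tau>\<^sub>1 u y" if "y \<in> D" "y \<notin> A" "y \<noteq> u" for y
    using that total(1)[of y u] by (simp add: A_def)
  have A1: "\<tau>\<^sub>1 x y" if "x \<in> A" "y \<in> D" "y \<notin> A" for x y
  proof -
    have xu: "\<tau>\<^sub>1 x u" using that(1) by (simp add: A_def)
    show ?thesis
    proof (cases "y = u")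
      case False
      then show ?thesis using transpD[OF p1(2) xu] top1 that by blast
    qed (use xu in simp)
  qed
  have A2: "\<tau>\<^sub>2 x y" if "x \<in> A" "y \<in> D" "y \<notin> A" for x y
  proof -
    have "x \<in> D" using that(1) by (simp add: A_def)
    then have "\<not> \<tau>\<^sub>2 y x" using A1[OF that] AX[OF that(1)] that(2) by (auto simp: X_def)
    moreover have "x \<noteq> y" using that by blast
    ultimately show ?thesis using total(2) by blast
  qed
  have "D - A \<noteq> {}" using uD uA by blast
  then obtain v where v: "v \<in> D - A" "\<And>y. y \<in> D - A \<Longrightarrow> y \<noteq> v \<Longrightarrow> \<tau>\<^sub>2 v y"
    using Finite_Set.bex_least_element[of "D - A" \<tau>\<^sub>2] finD p2
    by (auto intro: transp_on_subset totalp_on_subset)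
  have "y1 \<in> D - A" using y1(1,2) asym(1)[of u y1] by (simp add: A_def)
  have "u \<noteq> v"
  proof
    assume "u = v"
    moreover have "y1 \<noteq> u" using y1(2) irr(1) by blast
    ultimately have "\<tau>\<^sub>2 u y1" using v(2)[OF \<open>y1 \<in> D - A\<close>] by simp
    then show False using y1(3) asym(2) by blast
  qed
  have memD: "y \<in> D" if "mono_deg y = d" for y using that by (simp add: D_def)
  show ?thesis
  proof (rule that[of A d u v])
    show "A \<subseteq> {m. mono_deg m = d}" by (auto simp: A_def D_def)
    show "mono_deg u = d" "mono_deg v = d" using uD v(1) by (simp_all add: D_def)
    show "v \<notin> A" using v(1) by blast
    show "\<tau>\<^sub>1 x y \<and> \<tau>\<^sub>2 x y" if "x \<in> A" "mono_deg y = d" "y \<notin> A" for x y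
      using A1 A2 that memD by blast
    show "\<tau>\<^sub>1 u y" if "mono_deg y = d" "y \<notin> A" "y \<noteq> u" for y
      using top1 that memD by blast
    show "\<tau>\<^sub>2 v y" if "mono_deg y = d" "y \<notin> A" "y \<noteq> v" for y
      using v(2) that memD by blast
  qed (rule uA, rule \<open>u \<noteq> v\<close>)
qed

theorem theorem3p8:
  fixes \<tau>\<^sub>1 \<tau>\<^sub>2 :: "'n::{finite, linorder} mono \<Rightarrow> 'n mono \<Rightarrow> bool"
  assumes "monomial_order \<tau>\<^sub>1" and "monomial_order \<tau>\<^sub>2"
  shows "(\<forall>I :: ('n, 'k::{alg_closed_field, field_char_0}) mpoly set.
            is_ideal I \<longrightarrow> gin \<tau>\<^sub>1 I = gin \<tau>\<^sub>2 I)
         \<longleftrightarrow> \<tau>\<^sub>1 = \<tau>\<^sub>2"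
proof
  assume same: "\<forall>I :: ('n, 'k) mpoly set. is_ideal I \<longrightarrow> gin \<tau>\<^sub>1 I = gin \<tau>\<^sub>2 I"
  show "\<tau>\<^sub>1 = \<tau>\<^sub>2"
  proof (rule ccontr)
    assume neq: "\<tau>\<^sub>1 \<noteq> \<tau>\<^sub>2"
    obtain A d u v where A: "A \<subseteq> {m. mono_deg m = d}"
      and u: "mono_deg u = d" "u \<notin> A" and v: "mono_deg v = d" "v \<notin> A" and "u \<noteq> v"
      and top: "\<And>x y. x \<in> A \<Longrightarrow> mono_deg y = d \<Longrightarrow> y \<notin> A \<Longrightarrow> \<tau>\<^sub>1 x y \<and> \<tau>\<^sub>2 x y"
      and top1: "\<And>y. mono_deg y = d \<Longrightarrow> y \<notin> A \<Longrightarrow> y \<noteq> u \<Longrightarrow> \<tau>\<^sub>1 u y"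
      and top2: "\<And>y. mono_deg y = d \<Longrightarrow> y \<notin> A \<Longrightarrow> y \<noteq> v \<Longrightarrow> \<tau>\<^sub>2 v y"
      by (rule monomial_orders_separation[OF assms neq]) (rule that)
    have "finite A" using A finite_mono_deg_eq by (rule finite_subset)
    then obtain e where e: "bij_betw e {..<card A} A"
      using ex_bij_betw_nat_finite[of A] unfolding atLeast0LessThan by blast
    then have inj: "inj_on e {..<card A}" and img: "e ` {..<card A} = A"
      by (auto simp: bij_betw_def)
    have eA: "e k \<in> A" if "k < card A" for k using img that by blast
    define I :: "('n, 'k) mpoly set"
      where "I = forms_ideal d (Suc (card A)) (separating_form (card A) e u v)"
    have "is_ideal I"
      unfolding I_def
    proof (rule is_ideal_forms_ideal)
      show "separating_form (card A) e u v k \<in> (max_power d :: ('n, 'k) mpoly set)" for k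
        using eA A u(1) v(1) by (intro separating_form_in_max_power) auto
    qed
    note inf = infinite_UNIV_char_0[where 'a = 'k]
    have eD: "mono_deg (e k) = d" if "k < card A" for k
      using eA[OF that] A by blast
    have "(Poly_Mapping.single u 1 :: ('n, 'k) mpoly) \<in> gin \<tau>\<^sub>1 I
        \<longleftrightarrow> u \<in> insert u A"
      unfolding I_def
      by (rule mem_gin_separating[OF inf assms(1) inj eD, unfolded img,
            OF _ u v \<open>u \<noteq> v\<close> _ top1 u(1)])
        (simp_all add: top eA)
    moreover have "(Poly_Mapping.single u 1 :: ('n, 'k) mpoly) \<in> gin \<tau>\<^sub>2 I
        \<longleftrightarrow> u \<in> insert v A"
      unfolding I_def separating_form_commute[of _ _ u]
      by (rule mem_gin_separating[OF inf assms(2) inj eD, unfolded img,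
            OF _ v u \<open>u \<noteq> v\<close>[symmetric] _ top2 u(1)])
        (simp_all add: top eA)
    moreover have "u \<notin> insert v A"
      using \<open>u \<noteq> v\<close> u(2) by simp
    ultimately show False
      using same \<open>is_ideal I\<close> by blast
  qed
qed simp

end
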